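(* Let $(S,+)$ be a commutative semigroup, let $(y_{l,n})_{n\in\mathbb{Z}^\ast}\subseteq S$ for every $l\in\mathbb{Z}^\ast$, and let $\vec k=(k_n)_{n\in\mathbb{Z}^\ast}\subseteq\mathbb{N}$ be such that $(k_n)_{n\in\mathbb{N}}$ and $(k_{-n})_{n\in\mathbb{N}}$ are increasing sequences. For every family $\{x_s:s\in S\}$ of points of a compact metric space $(X,d)$ there exist $x_0\in X$ and, for every $n\in\mathbb{N}$, a function $s_n:\{1,\ldots,k_n\}\times\{1,\ldots,k_{-n}\}\to S$ of the form $$s_n(i,j)=\sum_{t\in C_n}y_{w_t,t}+\sum_{t\in V_n^+}y_{i,t}+\sum_{t\in V_n^-}y_{-j,t},$$ where $C_n=C_n^-\cup C_n^+\subseteq\mathbb{Z}^\ast$ with $\max C_{n+1}^-<\min C_n^-<\max C_n^+<\min C_{n+1}^+$, $V_n^+\subseteq\mathbb{N}$ with $\max V_n^+<\min V_{n+1}^+$ and $V_n^-\subseteq\mathbb{Z}^-$ with $\min V_n^->\max V_{n+1}^-$, such that $$R_1\text{-}\lim_{s\in FS[(s_n(i_n,j_n))_{n\in\mathbb{N}}]}x_s=x_0\qquad(\text{in particular }x_{s_n(i_n,j_n)}\to x_0),$$ uniformly for every $((i_n,j_n))_{n\in\mathbb{N}}\subseteq\mathbb{N}\times\mathbb{N}$ with $1\le i_n\le k_n$, $1\le j_n\le k_{-n}$.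
   Context: $\mathbb{N}=\{1,2,\ldots\}$, $\mathbb{Z}^-=\{-n:n\in\mathbb{N}\}$, $\mathbb{Z}^\ast=\mathbb{Z}\setminus\{0\}$. "Increasing" is in the weak sense. Here $C_n^-\subset\mathbb{Z}^-$, $C_n^+\subset\mathbb{N}$, $V_n^-$, $V_n^+$ are nonempty finite sets, with $C_n$ disjoint from $V_n^-\cup V_n^+$ (they are the constant positions and the negative/positive variable positions of a variable word), and for each $t\in C_n$ the letter $w_t$ is an integer with $w_t\in\{1,\ldots,k_t\}$ if $t>0$ and $w_t\in\{-k_t,\ldots,-1\}$ if $t<0$. $FS[(x_n)_n]$ is the set of finite sums $x_{n_1}+\cdots+x_{n_\lambda}$, $\lambda\in\mathbb{N}$, with $n_1<\cdots<n_\lambda$ in the index set. $R_1\text{-}\lim_{s\in FS[(s_n(i_n,j_n))_{n\in\mathbb{N}}]}x_s=x_0$ means: for every neighborhood $V$ of $x_0$ there is $n_0\in\mathbb{N}$ with $x_s\in V$ for every $s\in FS[(s_n(i_n,j_n))_{n\ge n_0}]$. Uniformly means that, for each $V$, one $n_0$ works for all admissible sequences $((i_n,j_n))_n$. *)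

theory Defs
  imports "HOL-Analysis.Analysis"
begin

text \<open>
  Sum over a finite nonempty index set in a commutative semigroup. The library's \<open>sum\<close> needs a
  neutral element; here the terms are added from left to right in increasing order of the indices.
  The value is meaningless if \<open>A\<close> is empty or infinite.
\<close>

definition sgsum :: "('i::linorder \<Rightarrow> 's::ab_semigroup_add) \<Rightarrow> 'i set \<Rightarrow> 's" where
  "sgsum f A =
     (let ts = sorted_list_of_set A in foldl (\<lambda>a t. a + f t) (f (hd ts)) (tl ts))"

lemma sgsum_singleton: "sgsum f {a} = f a"
  by (simp add: sgsum_def)

lemma foldl_add_insort:
  fixes f :: "'i::linorder \<Rightarrow> 's::ab_semigroup_add"
  shows "foldl (\<lambda>a t. a + f t) c (insort t ts) = foldl (\<lambda>a t. a + f t) (c + f t) ts"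
  by (induction ts arbitrary: c) (auto simp: ac_simps)

lemma foldl_add_shift:
  fixes f :: "'i \<Rightarrow> 's::ab_semigroup_add"
  shows "foldl (\<lambda>a t. a + f t) (b + c) ts = b + foldl (\<lambda>a t. a + f t) c ts"
  by (induction ts arbitrary: c) (auto simp: add.assoc)

lemma sgsum_insert:
  assumes "finite A" "A \<noteq> {}" "a \<notin> A"
  shows "sgsum f (insert a A) = f a + sgsum f A"
proof -
  obtain u us where u: "sorted_list_of_set A = u # us"
    using assms by (cases "sorted_list_of_set A") auto
  have "sorted_list_of_set (insert a A) = insort a (u # us)"
    using assms u by (simp add: sorted_list_of_set_insert)
  then show ?thesis
    using u by (auto simp: sgsum_def foldl_add_insort foldl_add_shift add.commute[of "f u"])
qed

definition FS :: "(nat \<Rightarrow> 's::ab_semigroup_add) \<Rightarrow> nat set \<Rightarrow> 's set" where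
  "FS z N = {sgsum z F | F. finite F \<and> F \<noteq> {} \<and> F \<subseteq> N}"

text \<open>
  \<open>R\<^sub>1\<close>-limit of \<open>x\<close> along the finite sums of \<open>z p\<close>, uniformly in the parameter \<open>p \<in> P\<close>.
  Sequences are indexed by the positive integers, hence \<open>n\<^sub>0 \<ge> 1\<close>; the value \<open>z p 0\<close> is never used.
\<close>

definition uniform_R1_lim ::
  "'p set \<Rightarrow> ('p \<Rightarrow> nat \<Rightarrow> 's::ab_semigroup_add) \<Rightarrow> ('s \<Rightarrow> 'x::topological_space) \<Rightarrow> 'x \<Rightarrow> bool" where
  "uniform_R1_lim P z x x0 \<longleftrightarrow>
     (\<forall>V. open V \<and> x0 \<in> V \<longrightarrow>
        (\<exists>n0\<ge>1. \<forall>p\<in>P. \<forall>s\<in>FS (z p) {n0..}. x s \<in> V))"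

definition index_seqs :: "(int \<Rightarrow> nat) \<Rightarrow> (nat \<Rightarrow> nat \<times> nat) set" where
  "index_seqs k = {p. \<forall>n\<ge>1. fst (p n) \<in> {1..k (int n)} \<and> snd (p n) \<in> {1..k (- int n)}}"

end

theory Submission
  imports Defs
begin

text \<open>
  Only words whose positions are symmetric under \<open>t \<mapsto> - t\<close> are used: the letter \<open>(i, j)\<close> at a
  position \<open>t \<ge> 1\<close> contributes \<open>y\<^bsub>i,t\<^esub> + y\<^bsub>-j,-t\<^esub>\<close>, which reduces the claim to located words over
  the increasing alphabets \<open>{1..k\<^sub>t} \<times> {1..k\<^bsub>-t\<^esub>}\<close>.

  For these, take a minimal idempotent ultrafilter \<open>p\<close> on the constant words and an idempotent
  ultrafilter \<open>q\<close> on the variable words with \<open>p q = q p = q\<close>. Substituting a letter for the variable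
  is a homomorphism that fixes the constant words, so it maps \<open>q\<close> to an idempotent below \<open>p\<close>, that
  is, to \<open>p\<close> itself. Let \<open>x\<^sub>0\<close> be the limit of \<open>x\<close> along \<open>p\<close>. Since every letter maps \<open>q\<close> to the
  idempotent \<open>p\<close>, the Galvin--Glazer construction can choose the variable words one after the other
  so that all their substituted sums from the \<open>n\<close>-th word on are mapped by \<open>x\<close> into the \<open>n\<close>-th ball
  around \<open>x\<^sub>0\<close>.

  Closed sets of ultrafilters are represented by filters, so that no topology on the space of
  ultrafilters is needed.
\<close>

section \<open>Ultrafilters as minimal filters\<close>

text \<open>Compactness in filter form. The infimum of a nonempty chain has only the events of its
  members, so it is \<open>bot\<close> only if some member is. Hence chains have proper lower bounds
  satisfying \<open>\<Phi>\<close>, and Zorn's lemma applies to the reversed order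
  \<open>?r\<close>.\<close>

lemma filter_minimal_exists:
  fixes F0 :: "'a filter"
  assumes "\<Phi> F0" "F0 \<noteq> bot"
    and Inf: "\<And>C. C \<noteq> {} \<Longrightarrow> (\<And>F. F \<in> C \<Longrightarrow> \<Phi> F) \<Longrightarrow> \<Phi> (Inf C)"
  obtains F where "\<Phi> F" "F \<noteq> bot" "\<And>G. G \<le> F \<Longrightarrow> G \<noteq> bot \<Longrightarrow> \<Phi> G \<Longrightarrow> G = F"
proof -
  let ?A = "{F. \<Phi> F \<and> F \<noteq> bot}"
  let ?r = "\<lambda>F G :: 'a filter. G \<le> F"
  have po: "partial_order_on ?A (relation_of ?r ?A)"
    by (rule partial_order_on_relation_ofI) auto
  have "\<exists>F\<in>?A. \<forall>G\<in>?A. ?r F G \<longrightarrow> G = F"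
  proof (rule predicate_Zorn[OF po])
    fix C assume C: "C \<in> Chains (relation_of ?r ?A)"
    show "\<exists>u\<in>?A. \<forall>a\<in>C. u \<le> a"
    proof (cases "C = {}")
      case True
      then show ?thesis using assms(1,2) by auto
    next
      case False
      have sub: "F \<in> ?A" if "F \<in> C" for F
        using C that by (auto simp: Chains_def relation_of_def)
      have lin: "F \<le> G \<or> G \<le> F" if "F \<in> C" "G \<in> C" for F G
        using C that by (auto simp: Chains_def relation_of_def)
      have "Inf C \<noteq> bot"
      proof
        assume "Inf C = bot"
        then have "eventually (\<lambda>_. False) (Inf C)" by simp
        moreover have "eventually (\<lambda>_. False) (Inf C) \<longleftrightarrow> (\<exists>b\<in>C. eventually (\<lambda>_. False) b)"
        proof (rule eventually_Inf_base[OF False])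
          show "\<exists>H\<in>C. H \<le> inf F G" if "F \<in> C" "G \<in> C" for F G
            using lin[OF that] that by (auto intro: bexI[of _ F] bexI[of _ G])
        qed
        ultimately show False
          using sub by (auto simp: trivial_limit_def)
      qed
      moreover have "\<Phi> (Inf C)" using Inf[OF False] sub by auto
      ultimately show ?thesis by (auto intro: Inf_lower)
    qed
  qed
  then show thesis using that by blast
qed

text \<open>Smaller filters have more events, so this is the usual maximality among proper filters
  of sets. In this form, a proper filter below an ultrafilter equals it.\<close>

definition ultra :: "'a filter \<Rightarrow> bool" where
  "ultra F \<longleftrightarrow> F \<noteq> bot \<and> (\<forall>G\<le>F. G \<noteq> bot \<longrightarrow> G = F)"

lemma ultra_nonbot: "ultra F \<Longrightarrow> F \<noteq> bot"
  by (simp add: ultra_def)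

lemma ultra_eqI: "ultra F \<Longrightarrow> G \<le> F \<Longrightarrow> G \<noteq> bot \<Longrightarrow> G = F"
  by (simp add: ultra_def)

lemma ultra_le_exists:
  assumes "F \<noteq> bot"
  obtains p where "ultra p" "p \<le> F"
proof -
  obtain p where p: "p \<le> F" "p \<noteq> bot" "\<And>G. G \<le> p \<Longrightarrow> G \<noteq> bot \<Longrightarrow> G \<le> F \<Longrightarrow> G = p"
    by (rule filter_minimal_exists[of "\<lambda>G. G \<le> F" F])
      (use assms in \<open>simp_all add: Inf_less_eq\<close>)
  have "ultra p"
    unfolding ultra_def
  proof (intro conjI allI impI)
    fix G assume "G \<le> p" "G \<noteq> bot"
    then show "G = p" using order_trans[OF _ p(1)] by (intro p(3))
  qed (rule p(2))
  then show thesis using p(1) by (rule that)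
qed

text \<open>Unless \<open>P\<close> eventually fails, cutting \<open>F\<close> down to
  \<open>P\<close> leaves a proper filter, which minimality identifies with \<open>F\<close>.
  Conversely, an event of a proper \<open>G \<le> F\<close> that \<open>F\<close> lacks would have
  its negation in \<open>F\<close>, hence in \<open>G\<close>.\<close>

lemma ultra_iff:
  "ultra F \<longleftrightarrow> F \<noteq> bot \<and> (\<forall>P. eventually P F \<or> eventually (\<lambda>x. \<not> P x) F)"
proof (intro iffI conjI allI)
  fix P assume F: "ultra F"
  show "eventually P F \<or> eventually (\<lambda>x. \<not> P x) F"
  proof (cases "inf F (principal {x. P x}) = bot")
    case True
    then have "eventually (\<lambda>_. False) (inf F (principal {x. P x}))" by simp
    then show ?thesis by (simp add: eventually_inf_principal)
  next
    case False
    then have "inf F (principal {x. P x}) = F" using F by (auto simp: ultra_def)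
    then have "F \<le> principal {x. P x}" by (metis inf.cobounded2)
    then show ?thesis by (simp add: le_principal)
  qed
next
  assume F: "F \<noteq> bot \<and> (\<forall>P. eventually P F \<or> eventually (\<lambda>x. \<not> P x) F)"
  have "F \<le> G" if "G \<le> F" "G \<noteq> bot" for G
  proof (rule filter_leI)
    fix P assume P: "eventually P G"
    show "eventually P F"
    proof (rule ccontr)
      assume "\<not> eventually P F"
      then have "eventually (\<lambda>x. \<not> P x) F" using F by auto
      then have "eventually (\<lambda>x. \<not> P x) G" using that filter_leD by blast
      with P have "eventually (\<lambda>_. False) G" by eventually_elim auto
      then show False using that by (simp add: trivial_limit_def)
    qed
  qed
  then show "ultra F" using F by (auto simp: ultra_def)
qed (simp add: ultra_def)

lemma ultra_not_eventually:
  assumes "ultra F"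
  shows "\<not> eventually P F \<longleftrightarrow> eventually (\<lambda>x. \<not> P x) F"
proof
  show "\<not> eventually P F \<Longrightarrow> eventually (\<lambda>x. \<not> P x) F"
    using assms by (auto simp: ultra_iff)
  show "\<not> eventually P F" if "eventually (\<lambda>x. \<not> P x) F"
  proof
    assume "eventually P F"
    with that have "eventually (\<lambda>_. False) F" by eventually_elim auto
    then show False using assms by (simp add: ultra_def trivial_limit_def)
  qed
qed

lemma ultra_filtermap: "ultra F \<Longrightarrow> ultra (filtermap h F)"
  by (auto simp: ultra_iff eventually_filtermap filtermap_bot_iff)

text \<open>Compactness gives a cluster point of the image; the image is an ultrafilter, so meeting
  it with \<open>nhds x0\<close> cannot shrink it and the cluster point is a limit.\<close>

lemma ultra_convergent:
  fixes h :: "'a \<Rightarrow> 'x::topological_space"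
  assumes "ultra F" "compact X" "\<And>a. h a \<in> X"
  obtains x0 where "x0 \<in> X" "(h \<longlongrightarrow> x0) F"
proof -
  let ?G = "filtermap h F"
  have G: "ultra ?G" using assms(1) by (rule ultra_filtermap)
  have "eventually (\<lambda>z. z \<in> X) ?G" using assms(3) by (simp add: eventually_filtermap)
  then obtain x0 where x0: "x0 \<in> X" "inf (nhds x0) ?G \<noteq> bot"
    using assms(2) G ultra_nonbot unfolding compact_filter by blast
  then have "inf (nhds x0) ?G = ?G" using G by (auto intro: ultra_eqI)
  then have "?G \<le> nhds x0" by (metis inf.cobounded1)
  with x0 that show thesis by (auto simp: filterlim_def)
qed

section \<open>Idempotent ultrafilters on a semigroup\<close>

context semigroup
begin

text \<open>On ultrafilters this is the usual product of the Stone-Cech compactification. Having it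
  for all filters lets \<open>F \<odot> F \<le> F\<close> express that the ultrafilters below
  \<open>F\<close> are closed under products.\<close>

definition filter_mult :: "'a filter \<Rightarrow> 'a filter \<Rightarrow> 'a filter"  (infixl "\<odot>" 70) where
  "F \<odot> G = Abs_filter (\<lambda>P. \<forall>\<^sub>F u in F. \<forall>\<^sub>F v in G. P (u \<^bold>* v))"

lemma eventually_filter_mult:
  "eventually P (F \<odot> G) \<longleftrightarrow> (\<forall>\<^sub>F u in F. \<forall>\<^sub>F v in G. P (u \<^bold>* v))"
  unfolding filter_mult_def
proof (rule eventually_Abs_filter, rule is_filter.intro)
  fix P Q :: "'a \<Rightarrow> bool"
  assume "\<forall>\<^sub>F u in F. \<forall>\<^sub>F v in G. P (u \<^bold>* v)" "\<forall>\<^sub>F u in F. \<forall>\<^sub>F v in G. Q (u \<^bold>* v)"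
  then show "\<forall>\<^sub>F u in F. \<forall>\<^sub>F v in G. P (u \<^bold>* v) \<and> Q (u \<^bold>* v)"
    by eventually_elim (rule eventually_conj)
next
  fix P Q :: "'a \<Rightarrow> bool"
  assume PQ: "\<forall>x. P x \<longrightarrow> Q x" and "\<forall>\<^sub>F u in F. \<forall>\<^sub>F v in G. P (u \<^bold>* v)"
  from this(2) show "\<forall>\<^sub>F u in F. \<forall>\<^sub>F v in G. Q (u \<^bold>* v)"
    by eventually_elim (use PQ in \<open>auto elim: eventually_mono\<close>)
qed simp

lemma filter_mult_assoc: "F \<odot> G \<odot> H = F \<odot> (G \<odot> H)"
  by (simp add: filter_eq_iff eventually_filter_mult assoc)

lemma filter_mult_mono:
  assumes "F \<le> F'" "G \<le> G'"
  shows "F \<odot> G \<le> F' \<odot> G'"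
proof (rule filter_leI)
  fix P assume "eventually P (F' \<odot> G')"
  then have "\<forall>\<^sub>F u in F. \<forall>\<^sub>F v in G'. P (u \<^bold>* v)"
    using assms(1) filter_leD unfolding eventually_filter_mult by blast
  then have "\<forall>\<^sub>F u in F. \<forall>\<^sub>F v in G. P (u \<^bold>* v)"
    by eventually_elim (use assms(2) filter_leD in blast)
  then show "eventually P (F \<odot> G)" by (simp add: eventually_filter_mult)
qed

lemma filter_mult_nonbot: "F \<noteq> bot \<Longrightarrow> G \<noteq> bot \<Longrightarrow> F \<odot> G \<noteq> bot"
  by (simp add: trivial_limit_def eventually_filter_mult)

lemma ultra_filter_mult:
  assumes "ultra F" "ultra G"
  shows "ultra (F \<odot> G)"
  unfolding ultra_iff
proof (intro conjI allI)
  show "F \<odot> G \<noteq> bot" using assms by (simp add: filter_mult_nonbot ultra_nonbot)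
  show "eventually P (F \<odot> G) \<or> eventually (\<lambda>x. \<not> P x) (F \<odot> G)" for P
    unfolding eventually_filter_mult using assms
    by (simp add: ultra_not_eventually[symmetric])
qed

lemma filtermap_filter_mult:
  assumes "\<And>u v. h (u \<^bold>* v) = h u \<^bold>* h v"
  shows "filtermap h (F \<odot> G) = filtermap h F \<odot> filtermap h G"
  by (simp add: filter_eq_iff eventually_filter_mult eventually_filtermap assms)

text \<open>The filter \<open>V\<close> corresponds to the closed set of all ultrafilters \<open>v \<le> F\<close> with \<open>v \<odot> p \<le> e\<close>.\<close>

lemma left_quotient_filter:
  assumes "ultra p" "e \<noteq> bot" "e \<le> F \<odot> p"
  obtains V where "V \<le> F" "V \<noteq> bot" "V \<odot> p \<le> e" "\<And>v. v \<le> F \<Longrightarrow> v \<odot> p \<le> e \<Longrightarrow> v \<le> V"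
proof
  \<comment> \<open>The preimage of \<open>e\<close> under right multiplication by \<open>p\<close>,
    within \<open>F\<close>: for each event \<open>P\<close> of \<open>e\<close>, the filter
    \<open>F\<close> is cut down to those \<open>u\<close> whose product with
    \<open>p\<close>-almost every \<open>v\<close> satisfies \<open>P\<close>.\<close>
  define V where "V = Abs_filter
    (\<lambda>Q. \<exists>P. eventually P e \<and> (\<forall>\<^sub>F u in F. (\<forall>\<^sub>F v in p. P (u \<^bold>* v)) \<longrightarrow> Q u))"
  have V: "eventually Q V \<longleftrightarrow>
      (\<exists>P. eventually P e \<and> (\<forall>\<^sub>F u in F. (\<forall>\<^sub>F v in p. P (u \<^bold>* v)) \<longrightarrow> Q u))" for Q
    unfolding V_def
  proof (rule eventually_Abs_filter, rule is_filter.intro)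
    show "\<exists>P. eventually P e \<and> (\<forall>\<^sub>F u in F. (\<forall>\<^sub>F v in p. P (u \<^bold>* v)) \<longrightarrow> True)"
      by (auto intro: exI[of _ "\<lambda>_. True"])
  next
    fix Q Q'
    assume "\<exists>P. eventually P e \<and> (\<forall>\<^sub>F u in F. (\<forall>\<^sub>F v in p. P (u \<^bold>* v)) \<longrightarrow> Q u)"
      and "\<exists>P. eventually P e \<and> (\<forall>\<^sub>F u in F. (\<forall>\<^sub>F v in p. P (u \<^bold>* v)) \<longrightarrow> Q' u)"
    then obtain P P' where P: "eventually P e" "\<forall>\<^sub>F u in F. (\<forall>\<^sub>F v in p. P (u \<^bold>* v)) \<longrightarrow> Q u"
      and P': "eventually P' e" "\<forall>\<^sub>F u in F. (\<forall>\<^sub>F v in p. P' (u \<^bold>* v)) \<longrightarrow> Q' u"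
      by blast
    have "eventually (\<lambda>x. P x \<and> P' x) e" using P P' by (simp add: eventually_conj)
    moreover have "\<forall>\<^sub>F u in F. (\<forall>\<^sub>F v in p. P (u \<^bold>* v) \<and> P' (u \<^bold>* v)) \<longrightarrow> Q u \<and> Q' u"
      using P(2) P'(2) by eventually_elim (auto simp: eventually_conj_iff)
    ultimately show "\<exists>P. eventually P e \<and> (\<forall>\<^sub>F u in F. (\<forall>\<^sub>F v in p. P (u \<^bold>* v)) \<longrightarrow> Q u \<and> Q' u)"
      by blast
  next
    fix Q Q' :: "'a \<Rightarrow> bool"
    assume QQ': "\<forall>x. Q x \<longrightarrow> Q' x"
      and "\<exists>P. eventually P e \<and> (\<forall>\<^sub>F u in F. (\<forall>\<^sub>F v in p. P (u \<^bold>* v)) \<longrightarrow> Q u)"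
    then obtain P where P: "eventually P e" "\<forall>\<^sub>F u in F. (\<forall>\<^sub>F v in p. P (u \<^bold>* v)) \<longrightarrow> Q u"
      by blast
    from P(2) have "\<forall>\<^sub>F u in F. (\<forall>\<^sub>F v in p. P (u \<^bold>* v)) \<longrightarrow> Q' u"
      by eventually_elim (use QQ' in blast)
    with P(1) show "\<exists>P. eventually P e \<and> (\<forall>\<^sub>F u in F. (\<forall>\<^sub>F v in p. P (u \<^bold>* v)) \<longrightarrow> Q' u)"
      by blast
  qed
  show "V \<le> F"
    by (rule filter_leI) (auto simp: V elim: eventually_mono intro: exI[of _ "\<lambda>_. True"])
  show "V \<odot> p \<le> e"
    by (rule filter_leI) (auto simp: V eventually_filter_mult)
  \<comment> \<open>Since \<open>p\<close> is an ultrafilter, "not \<open>p\<close>-eventually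
    \<open>P\<close>" becomes "\<open>p\<close>-eventually not \<open>P\<close>", which would make
    the negation of \<open>P\<close> an event of \<open>F \<odot> p\<close> and so of
    \<open>e\<close>.\<close>
  show "V \<noteq> bot"
  proof
    assume "V = bot"
    then have "eventually (\<lambda>_. False) V" by simp
    then obtain P where P: "eventually P e" "\<forall>\<^sub>F u in F. \<not> (\<forall>\<^sub>F v in p. P (u \<^bold>* v))"
      by (auto simp: V)
    then have "eventually (\<lambda>x. \<not> P x) (F \<odot> p)"
      using assms(1) by (simp add: eventually_filter_mult ultra_not_eventually)
    then have "eventually (\<lambda>x. \<not> P x) e" using assms(3) filter_leD by blast
    with P(1) have "eventually (\<lambda>_. False) e" by eventually_elim auto
    then show False using assms(2) by (simp add: trivial_limit_def)
  qed
  show "v \<le> V" if v: "v \<le> F" "v \<odot> p \<le> e" for v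
  proof (rule filter_leI)
    fix Q assume "eventually Q V"
    then obtain P where P: "eventually P e" "\<forall>\<^sub>F u in F. (\<forall>\<^sub>F v in p. P (u \<^bold>* v)) \<longrightarrow> Q u"
      by (auto simp: V)
    have "\<forall>\<^sub>F u in v. (\<forall>\<^sub>F v in p. P (u \<^bold>* v)) \<longrightarrow> Q u" using P(2) v(1) filter_leD by blast
    moreover have "\<forall>\<^sub>F u in v. \<forall>\<^sub>F v in p. P (u \<^bold>* v)"
      using P(1) v(2) filter_leD unfolding eventually_filter_mult[symmetric] by blast
    ultimately show "eventually Q v" by eventually_elim auto
  qed
qed

text \<open>The Ellis--Numakura lemma: for a minimal closed subsemigroup \<open>G\<close> and an
  ultrafilter \<open>p\<close> below it, both \<open>G \<odot> p\<close> and the solutions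
  \<open>v\<close> of \<open>v \<odot> p \<le> p\<close> are closed subsemigroups inside
  \<open>G\<close>. By minimality each is \<open>G\<close>, so \<open>p\<close> itself is a
  solution.\<close>

lemma idempotent_ultra_exists:
  assumes "F \<noteq> bot" "F \<odot> F \<le> F"
  obtains p where "ultra p" "p \<le> F" "p \<odot> p = p"
proof -
  obtain G where G: "G \<le> F \<and> G \<odot> G \<le> G" "G \<noteq> bot"
    and minG: "\<And>G'. G' \<le> G \<Longrightarrow> G' \<noteq> bot \<Longrightarrow> G' \<le> F \<and> G' \<odot> G' \<le> G' \<Longrightarrow> G' = G"
  proof (rule filter_minimal_exists[of "\<lambda>G. G \<le> F \<and> G \<odot> G \<le> G" F])
    fix C :: "'a filter set"
    assume C: "C \<noteq> {}" "\<And>G. G \<in> C \<Longrightarrow> G \<le> F \<and> G \<odot> G \<le> G"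
    have "Inf C \<odot> Inf C \<le> G" if "G \<in> C" for G
      using filter_mult_mono[of "Inf C" G "Inf C" G] C(2)[OF that] that
      by (meson Inf_lower order_trans)
    then show "Inf C \<le> F \<and> Inf C \<odot> Inf C \<le> Inf C"
      using C by (auto intro: Inf_greatest Inf_lower2)
  qed (use assms in auto)
  obtain p where p: "ultra p" "p \<le> G" using G(2) by (rule ultra_le_exists)
  have "G \<odot> p = G"
  proof (rule minG)
    show le: "G \<odot> p \<le> G" using filter_mult_mono[of G G p G] p G by auto
    show "G \<odot> p \<noteq> bot" using G p by (simp add: filter_mult_nonbot ultra_nonbot)
    have "G \<odot> p \<odot> (G \<odot> p) \<le> G \<odot> (G \<odot> p)"
      using le by (intro filter_mult_mono) auto
    also have "\<dots> \<le> G \<odot> p"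
      using G filter_mult_mono unfolding filter_mult_assoc[symmetric] by blast
    finally show "G \<odot> p \<le> F \<and> G \<odot> p \<odot> (G \<odot> p) \<le> G \<odot> p" using le G by auto
  qed
  then have "p \<le> G \<odot> p" using p by simp
  then obtain V where V: "V \<le> G" "V \<noteq> bot" "V \<odot> p \<le> p"
    and maxV: "\<And>v. v \<le> G \<Longrightarrow> v \<odot> p \<le> p \<Longrightarrow> v \<le> V"
    using left_quotient_filter[OF p(1) ultra_nonbot[OF p(1)]] by metis
  have "V \<odot> V \<le> V"
  proof (rule maxV)
    show "V \<odot> V \<le> G" using filter_mult_mono[OF V(1) V(1)] G by auto
    have "V \<odot> V \<odot> p \<le> V \<odot> p"
      using V unfolding filter_mult_assoc by (intro filter_mult_mono) auto
    then show "V \<odot> V \<odot> p \<le> p" using V by auto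
  qed
  then have "V = G" using V G by (intro minG) auto
  then have "p \<odot> p \<le> p" using V p filter_mult_mono[of p V p p] by auto
  then have "p \<odot> p = p" using p by (intro ultra_eqI filter_mult_nonbot ultra_nonbot)
  then show thesis using that p G by auto
qed

text \<open>A filter \<open>F\<close> with \<open>H \<odot> F \<le> F\<close> corresponds to a closed left ideal of the semigroup of
  ultrafilters below \<open>H\<close>; an idempotent in a minimal one is minimal.\<close>

lemma minimal_idempotent_ultra_exists:
  assumes "H \<noteq> bot" "H \<odot> H \<le> H"
  obtains p where "ultra p" "p \<le> H" "p \<odot> p = p"
    "\<And>r. ultra r \<Longrightarrow> r \<le> H \<Longrightarrow> r \<odot> r = r \<Longrightarrow> r \<odot> p = r \<Longrightarrow> p \<odot> r = r \<Longrightarrow> r = p"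
proof -
  obtain F where F: "F \<le> H \<and> H \<odot> F \<le> F" "F \<noteq> bot"
    and minF: "\<And>G. G \<le> F \<Longrightarrow> G \<noteq> bot \<Longrightarrow> G \<le> H \<and> H \<odot> G \<le> G \<Longrightarrow> G = F"
  proof (rule filter_minimal_exists[of "\<lambda>F. F \<le> H \<and> H \<odot> F \<le> F" H])
    fix C :: "'a filter set"
    assume C: "C \<noteq> {}" "\<And>G. G \<in> C \<Longrightarrow> G \<le> H \<and> H \<odot> G \<le> G"
    have "H \<odot> Inf C \<le> G" if "G \<in> C" for G
      using filter_mult_mono[of H H "Inf C" G] C(2)[OF that] that
      by (meson Inf_lower order_refl order_trans)
    then show "Inf C \<le> H \<and> H \<odot> Inf C \<le> Inf C"
      using C by (auto intro: Inf_greatest Inf_lower2)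
  qed (use assms in auto)
  have "F \<odot> F \<le> F" using filter_mult_mono[of F H F F] F by auto
  then obtain p where p: "ultra p" "p \<le> F" "p \<odot> p = p"
    using idempotent_ultra_exists F(2) by metis
  have "r = p" if r: "ultra r" "r \<le> H" "r \<odot> r = r" "r \<odot> p = r" "p \<odot> r = r" for r
  proof -
    have rF: "r \<le> F" using filter_mult_mono[OF r(2) p(2)] r(4) F by auto
    \<comment> \<open>A left ideal inside the minimal one is all of it, so \<open>p\<close> has the
      form \<open>V \<odot> r\<close>. Idempotence of \<open>r\<close> then gives
      \<open>p \<odot> r = p\<close>, while \<open>p \<odot> r = r\<close> by assumption.\<close>
    have "H \<odot> r = F"
    proof (rule minF)
      show le: "H \<odot> r \<le> F" using filter_mult_mono[OF order_refl rF, of H] F by auto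
      show "H \<odot> r \<noteq> bot" using assms r by (simp add: filter_mult_nonbot ultra_nonbot)
      have "H \<odot> (H \<odot> r) \<le> H \<odot> r"
        using assms(2) filter_mult_mono unfolding filter_mult_assoc[symmetric] by blast
      then show "H \<odot> r \<le> H \<and> H \<odot> (H \<odot> r) \<le> H \<odot> r" using le F by auto
    qed
    then have "p \<le> H \<odot> r" using p by simp
    then obtain V where V: "V \<noteq> bot" "V \<odot> r \<le> p"
      using left_quotient_filter[OF r(1) ultra_nonbot[OF p(1)]] by metis
    then have "V \<odot> r = p" using p r V by (intro ultra_eqI filter_mult_nonbot) (auto simp: ultra_nonbot)
    then have "p \<odot> r = p" using r(3) by (metis filter_mult_assoc)
    then show "r = p" using r by simp
  qed
  then show thesis using that p F by auto
qed

text \<open>\<open>H\<close> plays the role of the constant words, \<open>K\<close> of the variable words, and the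
  maps in \<open>\<T>\<close> are the substitutions.\<close>

lemma ultra_common_image:
  assumes "H \<noteq> bot" "H \<odot> H \<le> H"
    and K: "K \<noteq> bot" "K \<odot> K \<le> K" "H \<odot> K \<le> K" "K \<odot> H \<le> K"
    and hom: "\<And>T u v. T \<in> \<T> \<Longrightarrow> T (u \<^bold>* v) = T u \<^bold>* T v"
    and T_K: "\<And>T. T \<in> \<T> \<Longrightarrow> filtermap T K \<le> H"
    and T_H: "\<And>T. T \<in> \<T> \<Longrightarrow> \<forall>\<^sub>F u in H. T u = u"
  obtains p q where "ultra p" "p \<le> H" "p \<odot> p = p" "q \<noteq> bot" "q \<le> K"
    "\<And>T. T \<in> \<T> \<Longrightarrow> filtermap T q = p"
proof -
  obtain p where p: "ultra p" "p \<le> H" "p \<odot> p = p"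
    and minp: "\<And>r. ultra r \<Longrightarrow> r \<le> H \<Longrightarrow> r \<odot> r = r \<Longrightarrow> r \<odot> p = r \<Longrightarrow> p \<odot> r = r \<Longrightarrow> r = p"
    using minimal_idempotent_ultra_exists[OF assms(1,2)] by metis
  have "K \<odot> p \<odot> (K \<odot> p) \<le> K \<odot> p"
  proof -
    have "K \<odot> p \<odot> K \<le> K \<odot> H \<odot> K" using p by (intro filter_mult_mono) auto
    also have "\<dots> \<le> K \<odot> K" using K by (intro filter_mult_mono) auto
    also have "\<dots> \<le> K" by (rule K)
    finally show ?thesis
      unfolding filter_mult_assoc[symmetric] by (intro filter_mult_mono) auto
  qed
  moreover have "K \<odot> p \<noteq> bot" using K p by (simp add: filter_mult_nonbot ultra_nonbot)
  ultimately obtain e where e: "ultra e" "e \<le> K \<odot> p" "e \<odot> e = e"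
    using idempotent_ultra_exists by metis
  \<comment> \<open>Writing \<open>e\<close> as \<open>V \<odot> p\<close> shows
    \<open>e \<odot> p = e\<close>, because \<open>p\<close> is idempotent.\<close>
  then obtain V where V: "V \<noteq> bot" "V \<odot> p \<le> e"
    using left_quotient_filter[OF p(1) ultra_nonbot[OF e(1)]] by metis
  then have "V \<odot> p = e" using p e V by (intro ultra_eqI filter_mult_nonbot) (auto simp: ultra_nonbot)
  then have ep: "e \<odot> p = e" using p(3) by (metis filter_mult_assoc)
  \<comment> \<open>The factor \<open>p\<close> on the left makes \<open>p\<close> a left identity
    too; \<open>e \<odot> p = e\<close> keeps the product idempotent.\<close>
  define q where "q = p \<odot> e"
  have epe: "e \<odot> (p \<odot> e) = e"
    by (simp add: ep e(3) flip: filter_mult_assoc)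
  have q: "ultra q" "q \<odot> q = q" "q \<odot> p = q"
    unfolding q_def using p(1) e(1) by (simp_all add: ultra_filter_mult filter_mult_assoc ep epe)
  have pq: "p \<odot> q = q"
    unfolding q_def by (simp add: p(3) flip: filter_mult_assoc)
  have "q \<le> H \<odot> (K \<odot> p)" unfolding q_def using p e by (intro filter_mult_mono)
  also have "\<dots> \<le> K \<odot> H"
    unfolding filter_mult_assoc[symmetric] using K p by (intro filter_mult_mono)
  also have "\<dots> \<le> K" by (rule K)
  finally have qK: "q \<le> K" .
  \<comment> \<open>\<open>T\<close> fixes \<open>p\<close>, so the image of \<open>q\<close> is an
    idempotent below \<open>H\<close> with two-sided identity \<open>p\<close>; minimality leaves
    only \<open>p\<close>.\<close>
  have "filtermap T q = p" if T: "T \<in> \<T>" for T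
  proof (rule minp)
    have Tu: "\<forall>\<^sub>F u in p. T u = u" using T_H[OF T] p(2) by (rule filter_leD[rotated])
    have Tp: "filtermap T p = p"
      unfolding filter_eq_iff eventually_filtermap
      by (intro allI eventually_cong[OF Tu]) simp
    note T_mult = filtermap_filter_mult[of T, OF hom[OF T], symmetric]
    show "ultra (filtermap T q)" using q by (simp add: ultra_filtermap)
    show "filtermap T q \<le> H" using filtermap_mono[OF qK] T_K[OF T] by (rule order_trans)
    show "filtermap T q \<odot> filtermap T q = filtermap T q"
      by (simp add: T_mult q)
    show "filtermap T q \<odot> p = filtermap T q"
      using T_mult[of q p] by (simp add: Tp q)
    show "p \<odot> filtermap T q = filtermap T q"
      using T_mult[of p q] by (simp add: Tp pq)
  qed
  with p ultra_nonbot[OF q(1)] qK show thesis by (rule that)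
qed

end

section \<open>Sums over finite index sets\<close>

lemma sgsum_cong:
  assumes "finite A" "A \<noteq> {}" "\<And>t. t \<in> A \<Longrightarrow> f t = g t"
  shows "sgsum f A = sgsum g A"
  using assms by (induction rule: finite_ne_induct) (auto simp: sgsum_singleton sgsum_insert)

lemma sgsum_union_disjoint:
  assumes "finite A" "A \<noteq> {}" "finite B" "B \<noteq> {}" "A \<inter> B = {}"
  shows "sgsum f (A \<union> B) = sgsum f A + sgsum f B"
  using assms by (induction rule: finite_ne_induct) (auto simp: sgsum_singleton sgsum_insert add.assoc)

lemma sgsum_add:
  assumes "finite A" "A \<noteq> {}"
  shows "sgsum (\<lambda>t. f t + g t) A = sgsum f A + sgsum g A"
  using assms by (induction rule: finite_ne_induct) (auto simp: sgsum_singleton sgsum_insert ac_simps)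

lemma sgsum_image:
  assumes "finite A" "A \<noteq> {}" "inj_on h A"
  shows "sgsum f (h ` A) = sgsum (\<lambda>t. f (h t)) A"
  using assms by (induction rule: finite_ne_induct) (auto simp: sgsum_singleton sgsum_insert)

section \<open>Located words\<close>

text \<open>A located word is a finite map from positions to symbols; the symbol \<open>None\<close> is the variable.\<close>

type_synonym 'a word = "nat \<rightharpoonup> 'a option"

definition const_words :: "(nat \<Rightarrow> 'a set) \<Rightarrow> 'a word set" where
  "const_words A = {w. finite (dom w) \<and> dom w \<noteq> {} \<and> (\<forall>t l. w t = Some l \<longrightarrow> l \<in> Some ` A t)}"

text \<open>A constant letter is demanded besides the variable because the constant positions, too,
  have to form a nonempty set.\<close>

definition var_words :: "(nat \<Rightarrow> 'a set) \<Rightarrow> 'a word set" where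
  "var_words A = {w. finite (dom w) \<and> (\<forall>t a. w t = Some (Some a) \<longrightarrow> a \<in> A t) \<and>
     (\<exists>t. w t = Some None) \<and> (\<exists>t a. w t = Some (Some a))}"

text \<open>The result keeps the type of words with variables, so that substitution is an
  endomorphism of words.\<close>

definition subst :: "'a \<Rightarrow> 'a word \<Rightarrow> 'a word" where
  "subst a w = (\<lambda>t. map_option (\<lambda>l. Some (case l of None \<Rightarrow> a | Some b \<Rightarrow> b)) (w t))"

definition word_sum :: "('a \<Rightarrow> nat \<Rightarrow> 's::ab_semigroup_add) \<Rightarrow> 'a word \<Rightarrow> 's" where
  "word_sum f w = sgsum (\<lambda>t. f (the (the (w t))) t) (dom w)"

text \<open>Ultrafilters below it live on words of \<open>W\<close> starting beyond any given
  position. Overlaps of \<open>++\<close> thus become invisible, and the partial concatenation of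
  disjoint words can be treated as a total product.\<close>

definition tail_filter :: "'a word set \<Rightarrow> 'a word filter" where
  "tail_filter W = (INF n. principal {w \<in> W. dom w \<subseteq> {n<..}})"

lemma dom_subst: "dom (subst a w) = dom w"
  by (auto simp: subst_def dom_def)

lemma subst_map_add: "subst a (u ++ v) = subst a u ++ subst a v"
  by (auto simp: subst_def map_add_def split: option.splits)

lemma subst_const_word: "w \<in> const_words A \<Longrightarrow> subst a w = w"
  by (rule ext, auto simp: subst_def const_words_def map_option_case image_iff split: option.splits)

lemma subst_var_word:
  assumes "w \<in> var_words A" "mono A" "a \<in> A n" "dom w \<subseteq> {n<..}"
  shows "subst a w \<in> const_words A"
proof -
  have "(case l of None \<Rightarrow> a | Some b \<Rightarrow> b) \<in> A t" if "w t = Some l" for t l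
  proof (cases l)
    case None
    have "n \<le> t" using that assms(4) by auto
    then show ?thesis using None monoD[OF assms(2)] assms(3) by auto
  next
    case (Some b)
    then show ?thesis using that assms(1) by (auto simp: var_words_def)
  qed
  then have "\<forall>t l. subst a w t = Some l \<longrightarrow> l \<in> Some ` A t"
    by (auto simp: subst_def)
  moreover have "finite (dom w)" "dom w \<noteq> {}" using assms(1) by (auto simp: var_words_def)
  ultimately show ?thesis by (simp add: const_words_def dom_subst del: dom_eq_empty_conv)
qed

lemma word_sum_map_add:
  assumes "finite (dom u)" "dom u \<noteq> {}" "finite (dom v)" "dom v \<noteq> {}" "dom u \<inter> dom v = {}"
  shows "word_sum f (u ++ v) = word_sum f u + word_sum f v"
proof -
  have u: "(u ++ v) t = u t" if "t \<in> dom u" for t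
    using that assms(5) by (intro map_add_dom_app_simps(3)) auto
  have v: "(u ++ v) t = v t" if "t \<in> dom v" for t
    using that by (rule map_add_dom_app_simps(1))
  have "word_sum f (u ++ v) = sgsum (\<lambda>t. f (the (the ((u ++ v) t))) t) (dom u) +
      sgsum (\<lambda>t. f (the (the ((u ++ v) t))) t) (dom v)"
    unfolding word_sum_def dom_map_add Un_commute[of "dom v"] using assms by (rule sgsum_union_disjoint)
  also have "\<dots> = word_sum f u + word_sum f v"
    unfolding word_sum_def using assms u v by (intro arg_cong2[of _ _ _ _ "(+)"] sgsum_cong) simp_all
  finally show ?thesis .
qed

lemma eventually_tail_filter:
  "eventually P (tail_filter W) \<longleftrightarrow> (\<exists>n. \<forall>w\<in>W. dom w \<subseteq> {n<..} \<longrightarrow> P w)"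
proof -
  have "eventually P (tail_filter W) \<longleftrightarrow>
      (\<exists>n\<in>UNIV. eventually P (principal {w \<in> W. dom w \<subseteq> {n<..}}))"
    unfolding tail_filter_def
  proof (rule eventually_INF_base)
    show "\<exists>k\<in>UNIV. principal {w \<in> W. dom w \<subseteq> {k<..}} \<le>
        inf (principal {w \<in> W. dom w \<subseteq> {m<..}}) (principal {w \<in> W. dom w \<subseteq> {n<..}})" for m n
      by (rule bexI[of _ "max m n"]) auto
  qed simp
  also have "\<dots> \<longleftrightarrow> (\<exists>n. \<forall>w\<in>W. dom w \<subseteq> {n<..} \<longrightarrow> P w)"
    unfolding eventually_principal by blast
  finally show ?thesis .
qed

lemma tail_filter_nonbot:
  assumes "\<And>n. \<exists>w\<in>W. dom w \<subseteq> {n<..}"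
  shows "tail_filter W \<noteq> bot"
  unfolding trivial_limit_def eventually_tail_filter using assms by simp

section \<open>Ultrafilters on the semigroup of located words\<close>

interpretation word: semigroup "(++) :: 'a word \<Rightarrow> 'a word \<Rightarrow> 'a word"
  by standard simp

text \<open>Once \<open>u\<close> is fixed, almost every \<open>v\<close> starts past its finite
  domain, so only disjoint concatenations matter.\<close>

lemma tail_filter_mult:
  assumes fin: "\<And>u. u \<in> U \<Longrightarrow> finite (dom u)"
    and mem: "\<And>u v. u \<in> U \<Longrightarrow> v \<in> V \<Longrightarrow> dom u \<inter> dom v = {} \<Longrightarrow> u ++ v \<in> W"
  shows "word.filter_mult (tail_filter U) (tail_filter V) \<le> tail_filter W"
proof (rule filter_leI)
  fix P assume "eventually P (tail_filter W)"
  then obtain n where n: "\<forall>w\<in>W. dom w \<subseteq> {n<..} \<longrightarrow> P w"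
    unfolding eventually_tail_filter by (rule exE)
  have "\<forall>\<^sub>F v in tail_filter V. P (u ++ v)" if u: "u \<in> U" "dom u \<subseteq> {n<..}" for u
  proof -
    obtain m where m: "\<forall>t\<in>dom u. t \<le> m"
      using fin[OF u(1)] unfolding finite_nat_set_iff_bounded_le by (rule exE)
    have "P (u ++ v)" if v: "v \<in> V" "dom v \<subseteq> {max m n<..}" for v
    proof (rule n[rule_format, OF mem[OF u(1) v(1)]])
      show "dom u \<inter> dom v = {}" using m v(2) by force
      show "dom (u ++ v) \<subseteq> {n<..}" using u(2) v(2) by (auto simp: subset_iff)
    qed
    then show ?thesis unfolding eventually_tail_filter by blast
  qed
  then show "eventually P (word.filter_mult (tail_filter U) (tail_filter V))"
    unfolding word.eventually_filter_mult eventually_tail_filter[of _ U] by blast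
qed

lemma word_ultrafilters:
  fixes A :: "nat \<Rightarrow> 'a set"
  assumes "mono A" "\<And>n. n \<ge> 1 \<Longrightarrow> A n \<noteq> {}"
  obtains p q :: "'a word filter" where "ultra p" "p \<le> tail_filter (const_words A)"
    "word.filter_mult p p = p" "q \<noteq> bot" "q \<le> tail_filter (var_words A)"
    "\<And>a n. a \<in> A n \<Longrightarrow> filtermap (subst a) q = p"
proof -
  let ?H = "tail_filter (const_words A)" and ?K = "tail_filter (var_words A)"
  let ?T = "subst ` (\<Union>n. A n)"
  \<comment> \<open>Letters for sample words in every tail; \<open>A 0\<close> may be empty, so they
    are taken at positive positions.\<close>
  define c where "c n = (SOME a. a \<in> A n)" for n
  have c: "c n \<in> A n" if "n \<ge> 1" for n
    unfolding c_def using assms(2)[OF that] by (simp add: some_in_eq)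
  have fin: "finite (dom u)" if "u \<in> const_words A \<or> u \<in> var_words A" for u
    using that by (auto simp: const_words_def var_words_def)
  have H: "?H \<noteq> bot"
  proof (rule tail_filter_nonbot, rule bexI)
    fix n
    show "dom [Suc n \<mapsto> Some (c (Suc n))] \<subseteq> {n<..}" by simp
    show "[Suc n \<mapsto> Some (c (Suc n))] \<in> const_words A"
      using c by (auto simp: const_words_def)
  qed
  have K: "?K \<noteq> bot"
  proof (rule tail_filter_nonbot, rule bexI)
    fix n
    let ?w = "[Suc n \<mapsto> Some (c (Suc n)), Suc (Suc n) \<mapsto> None]"
    show "dom ?w \<subseteq> {n<..}" by auto
    have "?w (Suc n) = Some (Some (c (Suc n)))" "?w (Suc (Suc n)) = Some None" by simp_all
    then have "\<exists>t. ?w t = Some None" "\<exists>t a. ?w t = Some (Some a)" by blast+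
    moreover have "\<forall>t a. ?w t = Some (Some a) \<longrightarrow> a \<in> A t" using c by auto
    moreover have "finite (dom ?w)" by simp
    ultimately show "?w \<in> var_words A" by (simp only: var_words_def mem_Collect_eq simp_thms)
  qed
  have HH: "word.filter_mult ?H ?H \<le> ?H"
    by (rule tail_filter_mult) (auto simp: const_words_def map_add_Some_iff)
  \<comment> \<open>Covers all three ideal inequalities at once: the variable word among the factors
    supplies a variable and a constant letter, and disjointness prevents overwriting.\<close>
  have var_words_map_add: "u ++ v \<in> var_words A"
    if uv: "u \<in> var_words A \<or> v \<in> var_words A" "u \<in> const_words A \<union> var_words A"
      "v \<in> const_words A \<union> var_words A" "dom u \<inter> dom v = {}" for u v
  proof -
    have map_add: "(u ++ v) t = Some l" if "u t = Some l \<or> v t = Some l" for t l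
      using that uv(4) by (auto simp: map_add_Some_iff)
    obtain t t' a where "u t = Some None \<or> v t = Some None" "u t' = Some (Some a) \<or> v t' = Some (Some a)"
      using uv(1) unfolding var_words_def by blast
    then have "\<exists>t. (u ++ v) t = Some None" "\<exists>t a. (u ++ v) t = Some (Some a)"
      using map_add by blast+
    moreover have "\<forall>t a. (u ++ v) t = Some (Some a) \<longrightarrow> a \<in> A t"
      using uv(2,3) by (auto simp: const_words_def var_words_def map_add_Some_iff)
    moreover have "finite (dom (u ++ v))" using uv(2,3) fin by auto
    ultimately show ?thesis by (simp only: var_words_def mem_Collect_eq simp_thms)
  qed
  have KK: "word.filter_mult ?K ?K \<le> ?K" "word.filter_mult ?H ?K \<le> ?K"
    "word.filter_mult ?K ?H \<le> ?K"
    by (rule tail_filter_mult; simp add: fin var_words_map_add)+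
  have subst_K: "filtermap T ?K \<le> ?H" if T: "T \<in> ?T" for T
  proof (rule filter_leI)
    fix P assume "eventually P ?H"
    then obtain n where n: "\<forall>w\<in>const_words A. dom w \<subseteq> {n<..} \<longrightarrow> P w"
      unfolding eventually_tail_filter by (rule exE)
    obtain a m where a: "T = subst a" "a \<in> A m" using T by blast
    have "P (subst a w)" if "w \<in> var_words A" "dom w \<subseteq> {max m n<..}" for w
      using that subst_var_word[OF that(1) assms(1) a(2)]
      by (intro n[rule_format]) (auto simp: dom_subst subset_iff)
    then show "eventually P (filtermap T ?K)"
      unfolding eventually_filtermap eventually_tail_filter a(1) by blast
  qed
  have subst_H: "\<forall>\<^sub>F u in ?H. T u = u" if "T \<in> ?T" for T
    using that by (auto simp: eventually_tail_filter subst_const_word)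
  obtain p q where pq: "ultra p" "p \<le> ?H" "word.filter_mult p p = p" "q \<noteq> bot" "q \<le> ?K"
    "\<And>T. T \<in> ?T \<Longrightarrow> filtermap T q = p"
  proof (rule word.ultra_common_image[OF H HH K KK, of ?T])
    show "T (u ++ v) = T u ++ T v" if "T \<in> ?T" for T u v
      using that by (auto simp: subst_map_add)
  qed (simp_all only: subst_K subst_H)
  have "filtermap (subst a) q = p" if "a \<in> A n" for a n
    using that by (intro pq(6)) auto
  with pq(1-5) show thesis by (rule that)
qed

section \<open>The Galvin--Glazer construction of variable words\<close>

lemma located_words_limit:
  fixes A :: "nat \<Rightarrow> 'a set" and f :: "'a \<Rightarrow> nat \<Rightarrow> 's::ab_semigroup_add"
    and \<phi> :: "'s \<Rightarrow> 'x::metric_space"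
  assumes A: "mono A" "\<And>n. finite (A n)" "\<And>n. n \<ge> 1 \<Longrightarrow> A n \<noteq> {}"
    and X: "compact X" "\<And>s. \<phi> s \<in> X"
  obtains x0 W where "x0 \<in> X" "\<And>n. W n \<in> var_words A" "\<And>n. dom (W n) \<subseteq> {n<..}"
    "\<And>n s t. s \<in> dom (W n) \<Longrightarrow> t \<in> dom (W (Suc n)) \<Longrightarrow> s < t"
    "\<And>V. open V \<Longrightarrow> x0 \<in> V \<Longrightarrow> \<exists>n0\<ge>1. \<forall>a F. (\<forall>n\<ge>n0. a n \<in> A n) \<longrightarrow>
       finite F \<longrightarrow> F \<noteq> {} \<longrightarrow> F \<subseteq> {n0..} \<longrightarrow>
       \<phi> (sgsum (\<lambda>n. word_sum f (subst (a n) (W n))) F) \<in> V"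
proof -
  obtain p q :: "'a word filter" where p: "ultra p" "p \<le> tail_filter (const_words A)"
    "word.filter_mult p p = p" and q: "q \<noteq> bot" "q \<le> tail_filter (var_words A)"
    "\<And>a n. a \<in> A n \<Longrightarrow> filtermap (subst a) q = p"
    using word_ultrafilters[OF A(1,3)] by blast
  obtain x0 where x0: "x0 \<in> X" "((\<lambda>w. \<phi> (word_sum f w)) \<longlongrightarrow> x0) p"
    using ultra_convergent[OF p(1) X(1), of "\<lambda>w. \<phi> (word_sum f w)"] X(2) by blast
  have p_const: "\<forall>\<^sub>F v in p. v \<in> const_words A \<and> dom v \<subseteq> {n<..}" for n
    by (rule filter_leD[OF p(2)]) (auto simp: eventually_tail_filter)
  have q_var: "\<forall>\<^sub>F v in q. v \<in> var_words A \<and> dom v \<subseteq> {n<..}" for n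
    by (rule filter_leD[OF q(2)]) (auto simp: eventually_tail_filter)
  \<comment> \<open>By idempotence of \<open>p\<close>, almost every \<open>u\<close> in
    \<open>D\<close> stays in \<open>D\<close> when followed by almost every \<open>v\<close>. Each
    letter sends \<open>q\<close> to \<open>p\<close>, so \<open>q\<close>-almost every
    \<open>w\<close> has this property for all letters of the finite set \<open>A n\<close> at
    once.\<close>
  have choose: "\<exists>w\<in>var_words A. dom w \<subseteq> {m<..} \<and>
      (\<forall>a\<in>A n. subst a w \<in> D \<and> (\<forall>\<^sub>F v in p. subst a w ++ v \<in> D))"
    if D: "\<forall>\<^sub>F v in p. v \<in> D" for D n m
  proof -
    have "\<forall>\<^sub>F v in word.filter_mult p p. v \<in> D"
      using D by (simp only: p(3))
    then have "\<forall>\<^sub>F u in p. \<forall>\<^sub>F v in p. u ++ v \<in> D"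
      by (simp only: word.eventually_filter_mult)
    with D have "\<forall>\<^sub>F u in p. u \<in> D \<and> (\<forall>\<^sub>F v in p. u ++ v \<in> D)"
      by (rule eventually_conj)
    then have "\<forall>\<^sub>F w in q. subst a w \<in> D \<and> (\<forall>\<^sub>F v in p. subst a w ++ v \<in> D)" if "a \<in> A n" for a
      by (subst (asm) q(3)[OF that, symmetric]) (simp add: eventually_filtermap)
    then have "\<forall>\<^sub>F w in q. \<forall>a\<in>A n. subst a w \<in> D \<and> (\<forall>\<^sub>F v in p. subst a w ++ v \<in> D)"
      using A(2) by (simp add: eventually_ball_finite)
    with q_var[of m] have "\<forall>\<^sub>F w in q. w \<in> var_words A \<and> dom w \<subseteq> {m<..} \<and>
        (\<forall>a\<in>A n. subst a w \<in> D \<and> (\<forall>\<^sub>F v in p. subst a w ++ v \<in> D))"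
      by eventually_elim auto
    then show ?thesis unfolding Bex_def by (rule eventually_happens'[OF q(1)])
  qed
  \<comment> \<open>Intersecting with \<open>const_words A\<close> records finite nonempty domains,
    which are needed to split \<open>word_sum\<close>.\<close>
  define B where "B n = {v. \<phi> (word_sum f v) \<in> ball x0 (1 / Suc n)} \<inter> const_words A" for n
  have B: "\<forall>\<^sub>F v in p. v \<in> B n" for n
  proof -
    have "\<forall>\<^sub>F v in p. \<phi> (word_sum f v) \<in> ball x0 (1 / Suc n)"
      using x0(2) by (rule topological_tendstoD) auto
    with p_const[of 0] show ?thesis by eventually_elim (auto simp: B_def)
  qed
  \<comment> \<open>A state pairs the set in which later sums must stay with the variable word of
    stage \<open>n\<close>; the last clause allows the set to be shrunk for the next stage.\<close>
  define P where "P n S \<longleftrightarrow> (\<forall>\<^sub>F v in p. v \<in> fst S) \<and> fst S \<subseteq> B n \<and>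
      snd S \<in> var_words A \<and> dom (snd S) \<subseteq> {n<..} \<and>
      (\<forall>a\<in>A n. subst a (snd S) \<in> fst S \<and> (\<forall>\<^sub>F v in p. subst a (snd S) ++ v \<in> fst S))" for n S
  \<comment> \<open>Prepending a substituted word of this stage to a word of the next set leads back
    into the current set; the order condition on that set keeps such concatenations
    disjoint.\<close>
  define Q where "Q n S S' \<longleftrightarrow> fst S' \<subseteq> fst S \<and>
      (\<forall>a\<in>A n. \<forall>v\<in>fst S'. subst a (snd S) ++ v \<in> fst S) \<and>
      (\<forall>v\<in>insert (snd S') (fst S'). \<forall>s\<in>dom (snd S). \<forall>t\<in>dom v. s < t)" for n S S'
  have "\<exists>g. \<forall>n. P n (g n) \<and> Q n (g n) (g (Suc n))"
  proof (rule dependent_nat_choice)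
    obtain w where "w \<in> var_words A" "dom w \<subseteq> {0<..}"
      "\<forall>a\<in>A 0. subst a w \<in> B 0 \<and> (\<forall>\<^sub>F v in p. subst a w ++ v \<in> B 0)"
      using choose[OF B] by blast
    then have "P 0 (B 0, w)" using B[of 0] by (simp add: P_def)
    then show "\<exists>S. P 0 S" by (rule exI)
  next
    fix S n assume "P n S"
    obtain D w where S: "S = (D, w)" by (rule prod.exhaust)
    with \<open>P n S\<close> have D: "\<forall>\<^sub>F v in p. v \<in> D"
      and w: "w \<in> var_words A" "\<And>a. a \<in> A n \<Longrightarrow> \<forall>\<^sub>F v in p. subst a w ++ v \<in> D"
      by (simp_all add: P_def)
    have "finite (dom w)" using w by (simp add: var_words_def)
    then obtain m where m: "\<forall>s\<in>dom w. s \<le> m"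
      unfolding finite_nat_set_iff_bounded_le by (rule exE)
    \<comment> \<open>Each condition holds \<open>p\<close>-almost everywhere, the last one because
      \<open>A n\<close> is finite.\<close>
    define D' where "D' = {v \<in> D. v \<in> B (Suc n) \<and> dom v \<subseteq> {m<..} \<and> (\<forall>a\<in>A n. subst a w ++ v \<in> D)}"
    have "\<forall>\<^sub>F v in p. \<forall>a\<in>A n. subst a w ++ v \<in> D"
      using w(2) A(2) by (simp add: eventually_ball_finite)
    with D B[of "Suc n"] p_const[of m] have D': "\<forall>\<^sub>F v in p. v \<in> D'"
      by eventually_elim (auto simp: D'_def)
    obtain w' where w': "w' \<in> var_words A" "dom w' \<subseteq> {max m (Suc n)<..}"
      "\<forall>a\<in>A (Suc n). subst a w' \<in> D' \<and> (\<forall>\<^sub>F v in p. subst a w' ++ v \<in> D')"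
      using choose[OF D'] by blast
    have "P (Suc n) (D', w')" using D' w' by (auto simp: P_def D'_def)
    moreover have "Q n S (D', w')"
    proof -
      have "dom v \<subseteq> {m<..}" if "v \<in> insert w' D'" for v
        using that w'(2) by (auto simp: D'_def)
      then have "\<forall>v\<in>insert w' D'. \<forall>s\<in>dom w. \<forall>t\<in>dom v. s < t"
        using m by (meson greaterThan_iff le_less_trans subsetD)
      moreover have "D' \<subseteq> D" "\<forall>a\<in>A n. \<forall>v\<in>D'. subst a w ++ v \<in> D"
        by (auto simp: D'_def)
      ultimately show ?thesis by (simp only: Q_def S prod.sel simp_thms)
    qed
    ultimately show "\<exists>S'. P (Suc n) S' \<and> Q n S S'" by blast
  qed
  then obtain g where g: "\<And>n. P n (g n)" "\<And>n. Q n (g n) (g (Suc n))" by blast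
  define D where "D n = fst (g n)" for n
  define W where "W n = snd (g n)" for n
  have P: "D n \<subseteq> B n" "W n \<in> var_words A" "dom (W n) \<subseteq> {n<..}"
    "a \<in> A n \<Longrightarrow> subst a (W n) \<in> D n" for n a
    using g(1)[of n] by (simp_all add: P_def D_def W_def)
  have Q: "D (Suc n) \<subseteq> D n" "a \<in> A n \<Longrightarrow> v \<in> D (Suc n) \<Longrightarrow> subst a (W n) ++ v \<in> D n"
    "v = W (Suc n) \<or> v \<in> D (Suc n) \<Longrightarrow> s \<in> dom (W n) \<Longrightarrow> t \<in> dom v \<Longrightarrow> s < t" for n a v s t
    using g(2)[of n] unfolding Q_def D_def W_def by blast+
  have D_antimono: "D n \<subseteq> D m" if "m \<le> n" for m n
    using Q(1) that by (rule lift_Suc_antimono_le)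
  \<comment> \<open>Words are concatenated from the largest index down. Membership for every lower
    bound \<open>m\<close> yields \<open>u \<in> D (Suc b)\<close> for the tail, and prepending the
    word of \<open>b\<close> lands in \<open>D b\<close>.\<close>
  have sum: "\<exists>u. (\<forall>m. (\<forall>n\<in>F. m \<le> n) \<longrightarrow> u \<in> D m) \<and>
      sgsum (\<lambda>n. word_sum f (subst (a n) (W n))) F = word_sum f u"
    if "finite F" "F \<noteq> {}" "\<forall>n\<in>F. a n \<in> A n" for F a
    using that
  proof (induction F rule: finite_linorder_min_induct)
    case (insert b F)
    let ?u = "subst (a b) (W b)"
    show ?case
    proof (cases "F = {}")
      case True
      then show ?thesis
        using P(4)[of "a b" b] insert.prems D_antimono by (auto simp: sgsum_singleton)
    next
      case False
      then obtain u where u: "\<And>m. (\<forall>n\<in>F. m \<le> n) \<Longrightarrow> u \<in> D m"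
        and sum: "sgsum (\<lambda>n. word_sum f (subst (a n) (W n))) F = word_sum f u"
        using insert by auto
      have uD: "u \<in> D (Suc b)" using insert.hyps by (intro u) (auto simp: Suc_le_eq)
      then have "?u ++ u \<in> D b" using insert.prems by (intro Q) auto
      then have "?u ++ u \<in> D m" if "\<forall>n\<in>insert b F. m \<le> n" for m
        using that D_antimono[of m b] by auto
      moreover have "word_sum f (?u ++ u) = word_sum f ?u + word_sum f u"
      proof (rule word_sum_map_add)
        show "finite (dom ?u)" "dom ?u \<noteq> {}"
          using P(2)[of b] by (auto simp: dom_subst var_words_def)
        show "finite (dom u)" "dom u \<noteq> {}"
          using uD P(1)[of "Suc b"] by (auto simp: B_def const_words_def)
        show "dom ?u \<inter> dom u = {}"
          using Q(3)[of u b] uD by (auto simp: dom_subst)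
      qed
      moreover have "b \<notin> F" using insert.hyps by auto
      ultimately show ?thesis
        using False insert.hyps by (intro exI[of _ "?u ++ u"]) (simp add: sgsum_insert sum)
    qed
  qed simp
  have lim: "\<exists>n0\<ge>1. \<forall>a F. (\<forall>n\<ge>n0. a n \<in> A n) \<longrightarrow> finite F \<longrightarrow> F \<noteq> {} \<longrightarrow> F \<subseteq> {n0..} \<longrightarrow>
       \<phi> (sgsum (\<lambda>n. word_sum f (subst (a n) (W n))) F) \<in> V" if V: "open V" "x0 \<in> V" for V
  proof -
    obtain e where e: "e > 0" "ball x0 e \<subseteq> V" using V open_contains_ball by blast
    \<comment> \<open>The threshold used is \<open>Suc n0\<close>, which is at least 1; since
      \<open>D\<close> decreases, \<open>D n0\<close> still contains the words behind these
      sums.\<close>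
    obtain n0 where n0: "1 / Suc n0 < e" using e(1) nat_approx_posE by blast
    have "\<phi> (sgsum (\<lambda>n. word_sum f (subst (a n) (W n))) F) \<in> V"
      if a: "\<forall>n\<ge>Suc n0. a n \<in> A n" and F: "finite F" "F \<noteq> {}" "F \<subseteq> {Suc n0..}" for a F
    proof -
      obtain u where u: "u \<in> D n0" "sgsum (\<lambda>n. word_sum f (subst (a n) (W n))) F = word_sum f u"
        using sum[OF F(1,2), of a] a F(3) by (meson Suc_leD atLeast_iff subsetD)
      then have "u \<in> B n0" using P(1) by blast
      then have "\<phi> (word_sum f u) \<in> ball x0 e" using n0 by (auto simp: B_def)
      then show ?thesis using e(2) u(2) by auto
    qed
    then show ?thesis by (intro exI[of _ "Suc n0"]) auto
  qed
  show thesis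
  proof (rule that[of x0 W])
    show "s < t" if "s \<in> dom (W n)" "t \<in> dom (W (Suc n))" for n s t
      using Q(3)[of "W (Suc n)" n s t] that by simp
  qed (fact x0(1) P(2) P(3) lim)+
qed

section \<open>From located words to symmetric integer positions\<close>

theorem theorem3p5:
  fixes y :: "int \<Rightarrow> int \<Rightarrow> 's::ab_semigroup_add"
    and k :: "int \<Rightarrow> nat"
    and X :: "'x::metric_space set"
    and x :: "'s \<Rightarrow> 'x"
  assumes k_pos: "\<And>n. n \<noteq> 0 \<Longrightarrow> k n \<ge> 1"
    and k_incr_pos: "mono_on {1..} (\<lambda>n::nat. k (int n))"
    and k_incr_neg: "mono_on {1..} (\<lambda>n::nat. k (- int n))"
    and X: "compact X"
    and x: "\<And>s. x s \<in> X"
  shows "\<exists>x0 \<in> X. \<exists>(s :: nat \<Rightarrow> nat \<Rightarrow> nat \<Rightarrow> 's)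
      (Cm :: nat \<Rightarrow> int set) (Cp :: nat \<Rightarrow> int set) (Vm :: nat \<Rightarrow> int set) (Vp :: nat \<Rightarrow> int set)
      (w :: int \<Rightarrow> int).
    (\<forall>n\<ge>1.
        finite (Cm n) \<and> Cm n \<noteq> {} \<and> Cm n \<subseteq> {..<0} \<and>
        finite (Cp n) \<and> Cp n \<noteq> {} \<and> Cp n \<subseteq> {0<..} \<and>
        finite (Vm n) \<and> Vm n \<noteq> {} \<and> Vm n \<subseteq> {..<0} \<and>
        finite (Vp n) \<and> Vp n \<noteq> {} \<and> Vp n \<subseteq> {0<..} \<and>
        (Cm n \<union> Cp n) \<inter> (Vm n \<union> Vp n) = {} \<and>
        Max (Cm (Suc n)) < Min (Cm n) \<and> Min (Cm n) < Max (Cp n) \<and>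
        Max (Cp n) < Min (Cp (Suc n)) \<and>
        Max (Vp n) < Min (Vp (Suc n)) \<and> Min (Vm n) > Max (Vm (Suc n)) \<and>
        (\<forall>t\<in>Cp n. w t \<in> {1..int (k t)}) \<and>
        (\<forall>t\<in>Cm n. w t \<in> {- int (k t)..-1}) \<and>
        (\<forall>i\<in>{1..k (int n)}. \<forall>j\<in>{1..k (- int n)}.
           s n i j = sgsum (\<lambda>t. y (w t) t) (Cm n \<union> Cp n) + sgsum (\<lambda>t. y (int i) t) (Vp n)
                     + sgsum (\<lambda>t. y (- int j) t) (Vm n))) \<and>
    uniform_R1_lim (index_seqs k) (\<lambda>p n. s n (fst (p n)) (snd (p n))) x x0 \<and>
    uniform_limit (index_seqs k) (\<lambda>n p. x (s n (fst (p n)) (snd (p n)))) (\<lambda>_. x0) sequentially"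
proof -
  \<comment> \<open>The empty alphabet at 0 keeps \<open>A\<close> monotone whatever
    \<open>k 0\<close> is.\<close>
  define A where "A n = (if n = 0 then {} else {1..k (int n)} \<times> {1..k (- int n)})" for n :: nat
  define f where "f = (\<lambda>(i, j) n. y (int i) (int n) + y (- int j) (- int n))"
  have A: "mono A" "\<And>n. finite (A n)" "\<And>n. n \<ge> 1 \<Longrightarrow> A n \<noteq> {}"
  proof -
    show "mono A"
    proof (rule monoI)
      fix m n :: nat assume "m \<le> n"
      then show "A m \<subseteq> A n"
        using mono_onD[OF k_incr_pos, of m n] mono_onD[OF k_incr_neg, of m n]
        by (cases "m = 0") (auto simp: A_def)
    qed
    show "finite (A n)" for n by (simp add: A_def)
    show "A n \<noteq> {}" if "n \<ge> 1" for n
      using that k_pos[of "int n"] k_pos[of "- int n"] by (auto simp: A_def)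
  qed
  obtain x0 W where x0: "x0 \<in> X" and W: "\<And>n. W n \<in> var_words A"
      "\<And>n. dom (W n) \<subseteq> {n<..}"
      and W_less: "\<And>n s t. s \<in> dom (W n) \<Longrightarrow> t \<in> dom (W (Suc n)) \<Longrightarrow> s < t"
      and lim: "\<And>V. open V \<Longrightarrow> x0 \<in> V \<Longrightarrow> \<exists>n0\<ge>1. \<forall>a F. (\<forall>n\<ge>n0. a n \<in> A n) \<longrightarrow>
        finite F \<longrightarrow> F \<noteq> {} \<longrightarrow> F \<subseteq> {n0..} \<longrightarrow>
        x (sgsum (\<lambda>n. word_sum f (subst (a n) (W n))) F) \<in> V"
    by (rule located_words_limit[of A X x f, OF A X x], assumption, rule that)
  define C where "C n = {t. \<exists>a. W n t = Some (Some a)}" for n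
  define V where "V n = {t. W n t = Some None}" for n
  have CV: "C n \<union> V n = dom (W n)" "C n \<inter> V n = {}" "C n \<noteq> {}" "V n \<noteq> {}" for n
    using W(1)[of n] by (auto simp: C_def V_def var_words_def)
  have fin: "finite (C n)" "finite (V n)" for n
  proof -
    have "finite (C n \<union> V n)" using W(1)[of n] CV(1)[of n] by (simp add: var_words_def)
    then show "finite (C n)" "finite (V n)" by simp_all
  qed
  have pos: "0 < t" if "t \<in> C n \<union> V n" for n t
    using that W(2)[of n] unfolding CV by auto
  have CV_less: "s < t" if "s \<in> C n \<union> V n" "t \<in> C (Suc n) \<union> V (Suc n)" for n s t
    using that W_less unfolding CV by blast
  \<comment> \<open>The order of consecutive words extends to all pairs through the nonempty sets
    \<open>C n\<close>. These are therefore disjoint, and one letter function \<open>w\<close>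
    serves every \<open>n\<close>.\<close>
  have lt: "s < t" if "m < n" "s \<in> C m" "t \<in> C n" for m n s t
    using that
  proof (induction n arbitrary: t)
    case (Suc n)
    show ?case
    proof (cases "m = n")
      case True
      then show ?thesis using CV_less Suc.prems by blast
    next
      case False
      obtain r where "r \<in> C n" using CV(3) by blast
      then show ?thesis using Suc.IH[of r] CV_less[of r n t] Suc.prems False by auto
    qed
  qed simp
  have C_unique: "m = n" if "t \<in> C m" "t \<in> C n" for m n t
    using that lt[of m n t t] lt[of n m t t] by (cases m n rule: linorder_cases) auto
  \<comment> \<open>The constant letter at \<open>t\<close>, read from the only word having a
    constant there; elsewhere the value is arbitrary.\<close>
  define c where "c t = (the (the (W (THE n. t \<in> C n) t)))" for t
  have c: "W n t = Some (Some (c t))" if "t \<in> C n" for n t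
  proof -
    have "(THE n. t \<in> C n) = n" using that C_unique by blast
    then show ?thesis using that by (auto simp: c_def C_def)
  qed
  have c_A: "c t \<in> A t" if "t \<in> C n" for n t
    using c[OF that] W(1)[of n] unfolding var_words_def by blast
  \<comment> \<open>A letter is a pair: its first coordinate goes to \<open>t\<close>, its negated
    second coordinate to \<open>- t\<close>, as in \<open>f\<close>.\<close>
  define w where "w t = (if t > 0 then int (fst (c (nat t))) else - int (snd (c (nat (- t)))))" for t
  have w: "w (int t) = int (fst (c t))" "w (- int t) = - int (snd (c t))" if "t \<in> C n" for t n
    using pos[of t n] that by (auto simp: w_def)
  let ?neg = "\<lambda>t. - int t"
  define s where "s n i j = sgsum (\<lambda>t. y (w t) t) (?neg ` C n \<union> int ` C n) +
    sgsum (\<lambda>t. y (int i) t) (int ` V n) + sgsum (\<lambda>t. y (- int j) t) (?neg ` V n)" for n i j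
  have inj: "inj_on int B" "inj_on ?neg B" for B by (auto simp: inj_on_def)
  \<comment> \<open>Splitting the two terms of \<open>f\<close> at each position yields the two
    signed copies of \<open>C n\<close> and \<open>V n\<close>; the copies of \<open>C n\<close> are
    disjoint because 0 is not a position.\<close>
  have s: "s n i j = word_sum f (subst (i, j) (W n))" for n i j
  proof -
    let ?g = "\<lambda>t. f (the (the (subst (i, j) (W n) t))) t"
    have "word_sum f (subst (i, j) (W n)) = sgsum ?g (C n \<union> V n)"
      by (simp add: word_sum_def dom_subst CV)
    also have "\<dots> = sgsum ?g (C n) + sgsum ?g (V n)"
      using CV fin by (intro sgsum_union_disjoint) auto
    also have "sgsum ?g (C n) =
        sgsum (\<lambda>t. y (w (- int t)) (- int t) + y (w (int t)) (int t)) (C n)"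
      using CV fin by (intro sgsum_cong) (auto simp: subst_def c[of _ n] w[of _ n] f_def add.commute split: prod.splits)
    also have "\<dots> = sgsum (\<lambda>t. y (w t) t) (?neg ` C n) + sgsum (\<lambda>t. y (w t) t) (int ` C n)"
      using CV fin inj by (simp add: sgsum_add sgsum_image)
    also have "\<dots> = sgsum (\<lambda>t. y (w t) t) (?neg ` C n \<union> int ` C n)"
    proof -
      have "0 \<notin> C n" using pos[of 0 n] by auto
      then show ?thesis using CV fin by (intro sgsum_union_disjoint[symmetric]) auto
    qed
    also have "sgsum ?g (V n) = sgsum (\<lambda>t. y (int i) (int t) + y (- int j) (- int t)) (V n)"
      using CV fin by (intro sgsum_cong) (auto simp: subst_def V_def f_def)
    also have "\<dots> = sgsum (\<lambda>t. y (int i) t) (int ` V n) + sgsum (\<lambda>t. y (- int j) t) (?neg ` V n)"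
      using CV fin inj by (simp add: sgsum_add sgsum_image)
    finally show ?thesis by (simp add: s_def add.assoc)
  qed
  have R1: "uniform_R1_lim (index_seqs k) (\<lambda>p n. s n (fst (p n)) (snd (p n))) x x0"
    unfolding uniform_R1_lim_def
  proof (intro allI impI)
    fix U :: "'x set" assume U: "open U \<and> x0 \<in> U"
    obtain n0 where n0: "n0 \<ge> 1" "\<And>a F. (\<forall>n\<ge>n0. a n \<in> A n) \<Longrightarrow>
        finite F \<Longrightarrow> F \<noteq> {} \<Longrightarrow> F \<subseteq> {n0..} \<Longrightarrow>
        x (sgsum (\<lambda>n. word_sum f (subst (a n) (W n))) F) \<in> U"
      using lim[of U] U by blast
    have "x r \<in> U" if p: "p \<in> index_seqs k" and r: "r \<in> FS (\<lambda>n. s n (fst (p n)) (snd (p n))) {n0..}" for p r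
    proof -
      \<comment> \<open>Here \<open>n0 \<ge> 1\<close> matters: \<open>index_seqs\<close> restricts
        only positive indices, and \<open>A 0\<close> is empty.\<close>
      have "\<forall>n\<ge>n0. p n \<in> A n"
        using p n0(1) by (auto simp: index_seqs_def A_def mem_Times_iff)
      moreover obtain F where "r = sgsum (\<lambda>n. word_sum f (subst (p n) (W n))) F"
        "finite F" "F \<noteq> {}" "F \<subseteq> {n0..}"
        using r by (auto simp: FS_def s)
      ultimately show ?thesis using n0(2)[of p F] by simp
    qed
    then show "\<exists>n0\<ge>1. \<forall>p\<in>index_seqs k. \<forall>s\<in>FS (\<lambda>n. s n (fst (p n)) (snd (p n))) {n0..}. x s \<in> U"
      using n0(1) by blast
  qed
  have ul: "uniform_limit (index_seqs k) (\<lambda>n p. x (s n (fst (p n)) (snd (p n)))) (\<lambda>_. x0) sequentially"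
    unfolding uniform_limit_sequentially_iff
  proof (intro allI impI)
    fix e :: real assume "e > 0"
    then obtain n0 where n0: "\<And>p r. p \<in> index_seqs k \<Longrightarrow>
        r \<in> FS (\<lambda>n. s n (fst (p n)) (snd (p n))) {n0..} \<Longrightarrow> x r \<in> ball x0 e"
      using R1[unfolded uniform_R1_lim_def, rule_format, of "ball x0 e"]
      by (meson centre_in_ball open_ball)
    have "dist (x (s n (fst (p n)) (snd (p n)))) x0 < e" if "n \<ge> n0" "p \<in> index_seqs k" for n p
    proof -
      \<comment> \<open>A single term is the finite sum over a singleton, so the limit along finite
        sums applies to it.\<close>
      have "s n (fst (p n)) (snd (p n)) = sgsum (\<lambda>n. s n (fst (p n)) (snd (p n))) {n}"
        by (simp only: sgsum_singleton)
      moreover have "finite {n}" "{n} \<noteq> {}" "{n} \<subseteq> {n0..}" using that by auto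
      ultimately have "s n (fst (p n)) (snd (p n)) \<in> FS (\<lambda>n. s n (fst (p n)) (snd (p n))) {n0..}"
        unfolding FS_def by blast
      then show ?thesis using n0[OF that(2)] by (simp add: dist_commute)
    qed
    then show "\<exists>N. \<forall>n\<ge>N. \<forall>p\<in>index_seqs k. dist (x (s n (fst (p n)) (snd (p n)))) x0 < e"
      by blast
  qed
  have Max_Min: "Max B < Min B'" if "finite B" "B \<noteq> {}" "finite B'" "B' \<noteq> {}"
    "\<And>a b. a \<in> B \<Longrightarrow> b \<in> B' \<Longrightarrow> a < b" for B B' :: "int set"
    using that by simp
  have main: "finite (?neg ` C n) \<and> ?neg ` C n \<noteq> {} \<and> ?neg ` C n \<subseteq> {..<0} \<and>
        finite (int ` C n) \<and> int ` C n \<noteq> {} \<and> int ` C n \<subseteq> {0<..} \<and>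
        finite (?neg ` V n) \<and> ?neg ` V n \<noteq> {} \<and> ?neg ` V n \<subseteq> {..<0} \<and>
        finite (int ` V n) \<and> int ` V n \<noteq> {} \<and> int ` V n \<subseteq> {0<..} \<and>
        (?neg ` C n \<union> int ` C n) \<inter> (?neg ` V n \<union> int ` V n) = {} \<and>
        Max (?neg ` C (Suc n)) < Min (?neg ` C n) \<and> Min (?neg ` C n) < Max (int ` C n) \<and>
        Max (int ` C n) < Min (int ` C (Suc n)) \<and>
        Max (int ` V n) < Min (int ` V (Suc n)) \<and> Min (?neg ` V n) > Max (?neg ` V (Suc n)) \<and>
        (\<forall>t\<in>int ` C n. w t \<in> {1..int (k t)}) \<and>
        (\<forall>t\<in>?neg ` C n. w t \<in> {- int (k t)..-1}) \<and>
        (\<forall>i\<in>{1..k (int n)}. \<forall>j\<in>{1..k (- int n)}.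
           s n i j = sgsum (\<lambda>t. y (w t) t) (?neg ` C n \<union> int ` C n) + sgsum (\<lambda>t. y (int i) t) (int ` V n)
                     + sgsum (\<lambda>t. y (- int j) t) (?neg ` V n))" for n
  proof (intro conjI)
    show "(?neg ` C n \<union> int ` C n) \<inter> (?neg ` V n \<union> int ` V n) = {}"
    proof -
      have "int r \<noteq> - int t" if "r \<in> C n" for r t using pos[of r n] that by simp
      moreover have "0 \<notin> C n" using pos[of 0 n] by auto
      ultimately show ?thesis using CV(2)[of n] by auto
    qed
    have less: "s < t" if "s \<in> C n \<and> t \<in> C (Suc n) \<or> s \<in> V n \<and> t \<in> V (Suc n)" for s t
      using that CV_less[of s n t] by blast
    show "Max (?neg ` C (Suc n)) < Min (?neg ` C n)" "Max (int ` C n) < Min (int ` C (Suc n))"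
      "Max (int ` V n) < Min (int ` V (Suc n))" "Max (?neg ` V (Suc n)) < Min (?neg ` V n)"
      by (rule Max_Min; use CV(3,4) fin less in auto)+
    obtain t where t: "t \<in> C n" using CV(3) by blast
    have "Min (?neg ` C n) \<le> - int t" using fin t by simp
    also have "\<dots> < int t" using t pos[of t n] by simp
    also have "\<dots> \<le> Max (int ` C n)" using fin t by simp
    finally show "Min (?neg ` C n) < Max (int ` C n)" .
    \<comment> \<open>The bounds belong to the position \<open>t\<close>, not to the stage
      \<open>n\<close>, because words take their letter at \<open>t\<close> from
      \<open>A t\<close>.\<close>
    have c_bounds: "fst (c t) \<in> {1..k (int t)} \<and> snd (c t) \<in> {1..k (- int t)}" if "t \<in> C n" for t
      using c_A[OF that] by (auto simp: A_def mem_Times_iff split: if_splits)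
    show "\<forall>t\<in>int ` C n. w t \<in> {1..int (k t)}" "\<forall>t\<in>?neg ` C n. w t \<in> {- int (k t)..-1}"
      using c_bounds w[of _ n] by force+
    show "\<forall>i\<in>{1..k (int n)}. \<forall>j\<in>{1..k (- int n)}.
           s n i j = sgsum (\<lambda>t. y (w t) t) (?neg ` C n \<union> int ` C n) + sgsum (\<lambda>t. y (int i) t) (int ` V n)
                     + sgsum (\<lambda>t. y (- int j) t) (?neg ` V n)"
      by (simp add: s_def)
  qed (use CV(3,4) fin pos[of _ n] in auto)
  show ?thesis
    by (rule bexI[OF _ x0], rule exI[of _ s], rule exI[of _ "\<lambda>n. ?neg ` C n"],
        rule exI[of _ "\<lambda>n. int ` C n"], rule exI[of _ "\<lambda>n. ?neg ` V n"],
        rule exI[of _ "\<lambda>n. int ` V n"], rule exI[of _ w])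
      (rule conjI, intro allI impI, rule main, rule conjI, rule R1, rule ul)
qed

end
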